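(* If $G$ is a finite $4$-centralizer group, then the non-commuting graph $\mathcal{A}_G$ is L-integral.
   Context: A finite group $G$ is an $n$-centralizer group if the set $\{C_G(x) : x \in G\}$ of element centralizers has exactly $n$ distinct members (including $G = C_G(1)$). For a finite non-abelian group $G$ with centre $Z(G)$, the non-commuting graph $\mathcal{A}_G$ is the simple undirected graph with vertex set $G \setminus Z(G)$ in which two vertices $x,y$ are adjacent if and only if $xy \neq yx$. A finite graph is L-integral if all eigenvalues of its Laplacian matrix $D - A$ ($D$ the degree matrix, $A$ the adjacency matrix) are integers. *)

theory Defs
  imports
    "HOL-Algebra.Group"
    "Jordan_Normal_Form.Char_Poly"
    "Graph_Theory.Pair_Digraph"
begin

section \<open>Centralizers and the non-commuting graph\<close>

definition element_centralizer :: "('a, 'c) monoid_scheme \<Rightarrow> 'a \<Rightarrow> 'a set" where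
  "element_centralizer G x = {y \<in> carrier G. x \<otimes>\<^bsub>G\<^esub> y = y \<otimes>\<^bsub>G\<^esub> x}"

definition group_centre :: "('a, 'c) monoid_scheme \<Rightarrow> 'a set" where
  "group_centre G = {z \<in> carrier G. \<forall>x \<in> carrier G. z \<otimes>\<^bsub>G\<^esub> x = x \<otimes>\<^bsub>G\<^esub> z}"

definition n_centralizer_group :: "nat \<Rightarrow> ('a, 'c) monoid_scheme \<Rightarrow> bool" where
  "n_centralizer_group n G \<longleftrightarrow>
     group G \<and> finite (carrier G) \<and> card (element_centralizer G ` carrier G) = n"

text \<open>
  As usual in \<^theory>\<open>Graph_Theory.Digraph\<close>, a simple undirected graph is a symmetric
  loop-free digraph without parallel arcs: an edge is represented by its two orientations.
\<close>

definition non_commuting_graph :: "('a, 'c) monoid_scheme \<Rightarrow> ('a, 'a \<times> 'a) pre_digraph" where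
  "non_commuting_graph G = with_proj
     \<lparr> pverts = carrier G - group_centre G,
       parcs = {(x, y). x \<in> carrier G - group_centre G \<and> y \<in> carrier G - group_centre G \<and>
                  x \<otimes>\<^bsub>G\<^esub> y \<noteq> y \<otimes>\<^bsub>G\<^esub> x} \<rparr>"

lemma graph_non_commuting_graph:
  assumes "finite (carrier G)"
  shows "graph (non_commuting_graph G)"
proof -
  let ?V = "carrier G - group_centre G"
  have "finite (arcs (non_commuting_graph G))"
    by (rule finite_subset[of _ "?V \<times> ?V"])
      (use assms in \<open>auto simp: non_commuting_graph_def\<close>)
  then show ?thesis
    using assms
    by unfold_locales
      (auto simp: non_commuting_graph_def arc_to_ends_def symmetric_def intro!: symI)
qed

section \<open>Laplacian matrix and L-integrality\<close>

text \<open>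
  Matrices are indexed by natural numbers, so the matrices of a graph are taken with respect
  to an enumeration \<open>vs\<close> of its vertices. In a symmetric digraph the degree of a vertex is
  its out-degree.
\<close>

definition degree_matrix :: "('a, 'b) pre_digraph \<Rightarrow> 'a list \<Rightarrow> complex mat" where
  "degree_matrix G vs = mat (length vs) (length vs)
     (\<lambda>(i, j). if i = j then of_nat (out_degree G (vs ! i)) else 0)"

definition adjacency_matrix :: "('a, 'b) pre_digraph \<Rightarrow> 'a list \<Rightarrow> complex mat" where
  "adjacency_matrix G vs = mat (length vs) (length vs)
     (\<lambda>(i, j). if vs ! i \<rightarrow>\<^bsub>G\<^esub> vs ! j then 1 else 0)"

definition laplacian_matrix :: "('a, 'b) pre_digraph \<Rightarrow> 'a list \<Rightarrow> complex mat" where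
  "laplacian_matrix G vs = degree_matrix G vs - adjacency_matrix G vs"

text \<open>
  Different enumerations give Laplacians conjugate by a permutation matrix, hence with the
  same eigenvalues; the condition is imposed for all of them. The conjunct \<open>graph G\<close>
  includes finiteness, so an enumeration exists. The matrices are over the complex numbers,
  so every root of the characteristic polynomial is an eigenvalue.
\<close>

definition L_integral :: "('a, 'b) pre_digraph \<Rightarrow> bool" where
  "L_integral G \<longleftrightarrow> graph G \<and>
     (\<forall>vs. distinct vs \<and> set vs = verts G \<longrightarrow>
        (\<forall>k. eigenvalue (laplacian_matrix G vs) k \<longrightarrow> k \<in> \<int>))"

end

(*
  In a 4-centralizer group the three proper centralizers cover the group, since every element
  lies in its own centralizer. Whenever three proper subgroups cover a group, the intersection of
  two of them lies in the third, so two distinct proper centralizers meet only in the centre.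
  Hence non-central x and y commute iff their centralizers coincide: the non-commuting graph
  is complete multipartite. For such a graph, with n vertices, let f be a Laplacian eigenvector with
  eigenvalue k, total sum S, and sum s over a part of size m. Summing the eigenvalue equation
  over all vertices gives k S = 0, and over the part gives n s - m S = k s. So if k is neither
  0 nor n, all part sums vanish and the equation reads (n - m) f = k f on each part.
*)

theory Submission
  imports Defs
begin

section \<open>Coverings by proper subgroups\<close>

lemma (in group) subgroup_mult_mem_iff_left:
  assumes "subgroup H G" "x \<in> H" "y \<in> carrier G"
  shows "x \<otimes> y \<in> H \<longleftrightarrow> y \<in> H"
proof
  assume "x \<otimes> y \<in> H"
  then have "inv x \<otimes> (x \<otimes> y) \<in> H"
    using assms by (simp add: subgroup.m_closed subgroup.m_inv_closed)
  then show "y \<in> H"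
    using assms by (simp add: subgroup.mem_carrier flip: m_assoc)
qed (use assms in \<open>simp add: subgroup.m_closed\<close>)

lemma (in group) subgroup_mult_mem_iff_right:
  assumes "subgroup H G" "x \<in> carrier G" "y \<in> H"
  shows "x \<otimes> y \<in> H \<longleftrightarrow> x \<in> H"
proof
  assume "x \<otimes> y \<in> H"
  then have "x \<otimes> y \<otimes> inv y \<in> H"
    using assms by (simp add: subgroup.m_closed subgroup.m_inv_closed)
  then show "x \<in> H"
    using assms by (simp add: subgroup.mem_carrier m_assoc)
qed (use assms in \<open>simp add: subgroup.m_closed\<close>)

text \<open>Properness yields \<open>h\<close> outside \<open>K\<close> and \<open>k\<close> outside
  \<open>H\<close>; a cover would put \<open>h\<close> in \<open>H\<close> and \<open>k\<close> in
  \<open>K\<close>, and then \<open>h \<otimes> k\<close> escapes both.\<close>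

lemma (in group) union_two_proper_subgroups:
  assumes H: "subgroup H G" "H \<noteq> carrier G" and K: "subgroup K G" "K \<noteq> carrier G"
  shows "H \<union> K \<noteq> carrier G"
proof
  assume cover: "H \<union> K = carrier G"
  obtain h k where h: "h \<in> carrier G" "h \<notin> K" and k: "k \<in> carrier G" "k \<notin> H"
    using H K by (meson subgroup.subset subset_antisym subsetI)
  have "h \<in> H" "k \<in> K"
    using cover h k by auto
  then have "h \<otimes> k \<notin> H" "h \<otimes> k \<notin> K"
    using subgroup_mult_mem_iff_left[OF H(1), of h k] subgroup_mult_mem_iff_right[OF K(1), of h k] h k
    by auto
  then show False
    using cover h k m_closed by blast
qed

text \<open>Translate by some \<open>c\<close> outside \<open>H\<close> and \<open>K\<close>. For
  \<open>x\<close> in both, \<open>x \<otimes> c\<close> still avoids both, so \<open>c\<close> and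
  \<open>x \<otimes> c\<close> lie in \<open>L\<close>, and cancelling \<open>c\<close> leaves
  \<open>x\<close> in \<open>L\<close>.\<close>

lemma (in group) inter_subset_of_three_cover:
  assumes H: "subgroup H G" "H \<noteq> carrier G" and K: "subgroup K G" "K \<noteq> carrier G"
    and L: "subgroup L G" and cover: "H \<union> K \<union> L = carrier G"
  shows "H \<inter> K \<subseteq> L"
proof
  fix x assume x: "x \<in> H \<inter> K"
  then have xG: "x \<in> carrier G"
    using cover by blast
  obtain c where c: "c \<in> carrier G" "c \<notin> H" "c \<notin> K"
    using union_two_proper_subgroups[OF H K] cover by blast
  have cL: "c \<in> L"
    using c cover by blast
  have "x \<otimes> c \<notin> H" "x \<otimes> c \<notin> K"
    using subgroup_mult_mem_iff_left[OF H(1), of x c] subgroup_mult_mem_iff_left[OF K(1), of x c] x c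
    by auto
  then have "x \<otimes> c \<in> L"
    using cover xG c m_closed by blast
  then show "x \<in> L"
    using subgroup_mult_mem_iff_right[OF L, of x c] xG cL by auto
qed

section \<open>Commuting elements of a 4-centralizer group\<close>

lemma (in group) subgroup_element_centralizer:
  assumes "x \<in> carrier G"
  shows "subgroup (element_centralizer G x) G"
proof (rule subgroupI)
  fix a b assume "a \<in> element_centralizer G x" "b \<in> element_centralizer G x"
  then show "a \<otimes> b \<in> element_centralizer G x"
    using assms unfolding element_centralizer_def by simp (metis m_assoc)
next
  fix a assume "a \<in> element_centralizer G x"
  then have a: "a \<in> carrier G" and ax: "x \<otimes> a = a \<otimes> x"
    by (auto simp: element_centralizer_def)
  have "inv a \<otimes> x = inv a \<otimes> (x \<otimes> a) \<otimes> inv a"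
    using a assms by (simp add: m_assoc)
  also have "\<dots> = x \<otimes> inv a"
    using a assms by (simp add: ax flip: m_assoc)
  finally show "inv a \<in> element_centralizer G x"
    using a by (simp add: element_centralizer_def)
qed (use assms in \<open>auto simp: element_centralizer_def\<close>)

lemma (in group) element_centralizer_eq_carrier_iff:
  "x \<in> carrier G \<Longrightarrow> element_centralizer G x = carrier G \<longleftrightarrow> x \<in> group_centre G"
  by (auto simp: element_centralizer_def group_centre_def)

lemma four_centralizer_commute_iff:
  fixes G (structure)
  assumes G4: "n_centralizer_group 4 G"
    and x: "x \<in> carrier G - group_centre G" and y: "y \<in> carrier G - group_centre G"
  shows "x \<otimes> y = y \<otimes> x \<longleftrightarrow> element_centralizer G x = element_centralizer G y"
proof
  let ?C = "element_centralizer G"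
  interpret group G
    using G4 by (simp add: n_centralizer_group_def)
  have self: "z \<in> ?C z" if "z \<in> carrier G" for z
    using that by (simp add: element_centralizer_def)
  show "x \<otimes> y = y \<otimes> x" if "?C x = ?C y"
  proof -
    have "x \<in> ?C y"
      using self[of x] x that by blast
    then show ?thesis
      by (simp add: element_centralizer_def)
  qed
  assume comm: "x \<otimes> y = y \<otimes> x"
  show "?C x = ?C y"
  proof (rule ccontr)
    assume ne: "?C x \<noteq> ?C y"
    have proper: "?C x \<noteq> carrier G" "?C y \<noteq> carrier G"
      using x y element_centralizer_eq_carrier_iff by auto
    have one: "?C \<one> = carrier G"
      by (auto simp: element_centralizer_def)
    have sub: "{carrier G, ?C x, ?C y} \<subseteq> ?C ` carrier G"
      using x y one by (metis DiffD1 empty_subsetI imageI insert_subset one_closed)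
    \<comment> \<open>By \<open>ne\<close> and \<open>proper\<close> the three removed centralizers
      are distinct, so just one of the four remains.\<close>
    have "card (?C ` carrier G - {carrier G, ?C x, ?C y}) = 1"
      using G4 ne proper sub by (subst card_Diff_subset) (auto simp: n_centralizer_group_def)
    then obtain D where D: "?C ` carrier G - {carrier G, ?C x, ?C y} = {D}"
      by (auto simp: card_1_singleton_iff)
    have "D \<in> ?C ` carrier G - {carrier G, ?C x, ?C y}"
      by (simp add: D)
    then obtain w where w: "w \<in> carrier G" "?C w = D"
      by auto
    have cases: "?C z \<in> {carrier G, ?C x, ?C y, D}" if "z \<in> carrier G" for z
    proof -
      have "?C ` carrier G \<subseteq> {carrier G, ?C x, ?C y} \<union> {D}"
        unfolding D[symmetric] Un_Diff_cancel by (rule Un_upper2)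
      from subsetD[OF this imageI[OF that]] show ?thesis
        by simp (elim disjE; simp)
    qed
    have cover: "?C x \<union> ?C y \<union> D = carrier G"
    proof (intro equalityI subsetI)
      fix z assume z: "z \<in> carrier G"
      show "z \<in> ?C x \<union> ?C y \<union> D"
      \<comment> \<open>A central \<open>z\<close> commutes with \<open>x\<close> and so lies in
        \<open>?C x\<close>; any other \<open>z\<close> lies in its own centralizer, which is one of
        the three proper ones.\<close>
      proof (cases "?C z = carrier G")
        case True
        then have "x \<in> ?C z"
          using x by simp
        then show ?thesis
          using z by (simp add: element_centralizer_def)
      next
        case False
        then show ?thesis
          using cases[OF z] self[OF z] by auto
      qed
    qed (use w in \<open>auto simp: element_centralizer_def\<close>)
    have "x \<in> ?C x \<inter> ?C y"
      using x y comm by (auto simp: element_centralizer_def)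
    moreover from this have "x \<in> D"
      using inter_subset_of_three_cover[of "?C x" "?C y" D] subgroup_element_centralizer
        proper cover w x y by blast
    \<comment> \<open>Now \<open>x\<close> lies in all four centralizers, so it commutes with
      everything, although it was chosen non-central.\<close>
    ultimately have "x \<in> ?C z" if "z \<in> carrier G" for z
      using cases[OF that] x by auto
    then have "x \<in> group_centre G"
      using x by (auto simp: element_centralizer_def group_centre_def)
    then show False
      using x by simp
  qed
qed

section \<open>Laplacian eigenvalues of complete multipartite graphs\<close>

text \<open>Moves an eigenvector from list positions to vertices, so that later arguments can sum
  over sets of vertices without the enumeration \<open>vs\<close>.\<close>

lemma laplacian_eigenfunction:
  assumes vs: "distinct vs" "set vs = verts G"
    and ev: "eigenvalue (laplacian_matrix G vs) k"
  obtains f where "\<exists>x\<in>verts G. f x \<noteq> 0"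
    and "\<And>x. x \<in> verts G \<Longrightarrow>
      of_nat (out_degree G x) * f x - (\<Sum>y | y \<in> verts G \<and> x \<rightarrow>\<^bsub>G\<^esub> y. f y) = k * f x"
proof -
  let ?n = "length vs"
  have dim: "laplacian_matrix G vs \<in> carrier_mat ?n ?n"
    unfolding laplacian_matrix_def degree_matrix_def adjacency_matrix_def
    by (intro minus_carrier_mat mat_carrier)
  then obtain v where v: "v \<in> carrier_vec ?n" "v \<noteq> 0\<^sub>v ?n"
    and eq: "laplacian_matrix G vs *\<^sub>v v = k \<cdot>\<^sub>v v"
    using ev by (auto simp: eigenvalue_def eigenvector_def)
  have bij: "bij_betw (\<lambda>i. vs ! i) {0..<?n} (verts G)"
    using bij_betw_nth[OF vs(1)] vs(2) by (simp add: atLeast0LessThan)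
  define f where "f x = v $ the_inv_into {0..<?n} (\<lambda>i. vs ! i) x" for x
  have f: "f (vs ! i) = v $ i" if "i < ?n" for i
    using that bij by (simp add: f_def bij_betw_def the_inv_into_f_f)
  show ?thesis
  proof
    obtain i where "i < ?n" "v $ i \<noteq> 0"
      using v by (metis carrier_vecD eq_vecI index_zero_vec)
    then show "\<exists>x\<in>verts G. f x \<noteq> 0"
      using f vs(2) by (metis nth_mem)
  next
    fix x assume "x \<in> verts G"
    then obtain i where i: "i < ?n" "vs ! i = x"
      using vs(2) by (metis in_set_conv_nth)
    \<comment> \<open>The row of the Laplacian at \<open>x\<close>, indexed by vertices. Since
      \<open>vs\<close> is distinct, the diagonal test on indices agrees with equality of
      vertices.\<close>
    let ?d = "\<lambda>y. (if x = y then of_nat (out_degree G x) else 0) - (if x \<rightarrow>\<^bsub>G\<^esub> y then 1 else 0)"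
    have fin: "finite (verts G)"
      using vs(2) by (metis finite_set)
    have "k * f x = (laplacian_matrix G vs *\<^sub>v v) $ i"
      using eq i v f[OF i(1)] by simp
    also have "\<dots> = (\<Sum>j = 0..<?n. laplacian_matrix G vs $$ (i, j) * v $ j)"
      using dim i v by (auto simp: scalar_prod_def)
    also have "\<dots> = (\<Sum>j = 0..<?n. ?d (vs ! j) * f (vs ! j))"
      using i f vs(1)
      by (intro sum.cong)
        (auto simp: laplacian_matrix_def degree_matrix_def adjacency_matrix_def nth_eq_iff_index_eq)
    also have "\<dots> = (\<Sum>y\<in>verts G. ?d y * f y)"
      by (rule sum.reindex_bij_betw[OF bij])
    also have "\<dots> = (\<Sum>y\<in>verts G. if x = y then of_nat (out_degree G x) * f y else 0)
        - (\<Sum>y\<in>verts G. if x \<rightarrow>\<^bsub>G\<^esub> y then f y else 0)"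
      unfolding sum_subtractf[symmetric] by (intro sum.cong) (auto simp: algebra_simps)
    also have "\<dots> = of_nat (out_degree G x) * f x - (\<Sum>y | y \<in> verts G \<and> x \<rightarrow>\<^bsub>G\<^esub> y. f y)"
      using fin \<open>x \<in> verts G\<close> by (simp add: sum.If_cases Int_def)
    finally show "of_nat (out_degree G x) * f x - (\<Sum>y | y \<in> verts G \<and> x \<rightarrow>\<^bsub>G\<^esub> y. f y) = k * f x"
      by simp
  qed
qed

text \<open>The out-degree counts arcs; without parallel arcs, \<open>head G\<close> is injective on
  the arcs leaving \<open>x\<close>.\<close>

lemma (in nomulti_digraph) out_degree_eq_card_neighbours:
  "out_degree G x = card {y \<in> verts G. x \<rightarrow>\<^bsub>G\<^esub> y}"
proof -
  have "inj_on (head G) (out_arcs G x)"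
    by (auto intro!: inj_onI no_multi_arcs simp: arc_to_ends_def)
  moreover have "{y \<in> verts G. x \<rightarrow>\<^bsub>G\<^esub> y} = head G ` out_arcs G x"
    by (auto simp: arcs_ends_def arc_to_ends_def image_iff)
  ultimately show ?thesis
    by (simp add: out_degree_def card_image)
qed

text \<open>The parts are the fibres of the labelling \<open>p\<close>. Every eigenvalue turns out
  to be 0, the order of the graph, or that order minus the size of a part.\<close>

lemma L_integral_complete_multipartite:
  assumes G: "graph G"
    and multi: "\<And>x y. x \<in> verts G \<Longrightarrow> y \<in> verts G \<Longrightarrow> x \<rightarrow>\<^bsub>G\<^esub> y \<longleftrightarrow> p x \<noteq> p y"
  shows "L_integral G"
  unfolding L_integral_def
proof (intro conjI allI impI G)
  fix vs k assume vs: "distinct vs \<and> set vs = verts G" and ev: "eigenvalue (laplacian_matrix G vs) k"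
  interpret graph G
    by (rule G)
  let ?V = "verts G"
  obtain f where nz: "\<exists>x\<in>?V. f x \<noteq> 0" and eq: "\<And>x. x \<in> ?V \<Longrightarrow>
      of_nat (out_degree G x) * f x - (\<Sum>y | y \<in> ?V \<and> x \<rightarrow>\<^bsub>G\<^esub> y. f y) = k * f x"
    using laplacian_eigenfunction[OF _ _ ev] vs by blast
  define P where "P x = {y \<in> ?V. p x = p y}" for x
  define n where "n = (of_nat (card ?V) :: complex)"
  define m where "m x = (of_nat (card (P x)) :: complex)" for x
  define S where "S = sum f ?V"
  define s where "s x = sum f (P x)" for x
  have PV: "P x \<subseteq> ?V" and finP: "finite (P x)" for x
    by (auto simp: P_def)
  have nbr: "{y \<in> ?V. x \<rightarrow>\<^bsub>G\<^esub> y} = ?V - P x" if "x \<in> ?V" for x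
    using multi that by (auto simp: P_def)
  \<comment> \<open>The neighbours of \<open>x\<close> are exactly the vertices outside
    \<open>P x\<close>, which gives both the degree and the neighbour sum.\<close>
  have local: "(n - m x) * f x - (S - s x) = k * f x" if "x \<in> ?V" for x
  proof -
    have "of_nat (out_degree G x) = n - m x"
      using that PV[of x]
      by (simp add: out_degree_eq_card_neighbours nbr n_def m_def card_Diff_subset finP of_nat_diff card_mono)
    then show ?thesis
      using eq[OF that] PV[of x] by (simp add: nbr that S_def s_def sum_diff)
  qed
  \<comment> \<open>Sum \<open>local\<close> over \<open>P x\<close>, on which \<open>m\<close> and
    \<open>s\<close> are constant; the two terms \<open>m x * s x\<close> cancel.\<close>
  have part: "n * s x - m x * S = k * s x" if "x \<in> ?V" for x
  proof -
    have Py: "P y = P x" if "y \<in> P x" for y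
      using that by (auto simp: P_def)
    have "(\<Sum>y\<in>P x. (n - m x) * f y - (S - s x)) = (\<Sum>y\<in>P x. k * f y)"
    proof (intro sum.cong refl)
      fix y assume "y \<in> P x"
      then show "(n - m x) * f y - (S - s x) = k * f y"
        using local[of y] PV[of x] Py[of y] by (auto simp: m_def s_def)
    qed
    then have "(n - m x) * s x - m x * (S - s x) = k * s x"
      by (simp add: sum_subtractf flip: sum_distrib_left) (simp add: s_def m_def)
    then show ?thesis
      by (simp add: algebra_simps)
  qed
  \<comment> \<open>Double counting over pairs in a common part: each \<open>f y\<close> occurs once
    for every member of the part of \<open>y\<close>.\<close>
  have swap: "(\<Sum>x\<in>?V. s x) = (\<Sum>x\<in>?V. m x * f x)"
  proof -
    have "(\<Sum>x\<in>?V. s x) = (\<Sum>x\<in>?V. \<Sum>y\<in>?V. if p x = p y then f y else 0)"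
      by (simp add: s_def P_def sum.If_cases Int_def)
    also have "\<dots> = (\<Sum>y\<in>?V. \<Sum>x\<in>?V. if p y = p x then f y else 0)"
      by (subst sum.swap) (simp add: eq_commute)
    also have "\<dots> = (\<Sum>x\<in>?V. m x * f x)"
      by (simp add: m_def P_def sum.If_cases Int_def)
    finally show ?thesis .
  qed
  have "(\<Sum>x\<in>?V. (n - m x) * f x - (S - s x)) = (\<Sum>x\<in>?V. k * f x)"
    using local by (intro sum.cong) auto
  \<comment> \<open>The left side is \<open>n * S - n * S\<close> plus the difference of the two
    sums in \<open>swap\<close>, hence 0.\<close>
  then have total: "k * S = 0"
    by (simp add: sum_subtractf left_diff_distrib swap flip: sum_distrib_left)
      (simp add: S_def n_def)
  show "k \<in> \<int>"
  proof (cases "k = 0 \<or> k = n")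
    case True
    then show ?thesis
      by (auto simp: n_def)
  next
    case False
    then have S0: "S = 0"
      using total by simp
    obtain x where x: "x \<in> ?V" "f x \<noteq> 0"
      using nz by blast
    \<comment> \<open>With \<open>S = 0\<close>, \<open>part\<close> reads
      \<open>n * s x = k * s x\<close>, and \<open>k\<close> differs from \<open>n\<close>.\<close>
    have "s x = 0"
      using part[OF x(1)] S0 False by auto
    then have "k = n - m x"
      using local[OF x(1)] S0 x(2) by simp
    then show ?thesis
      by (simp add: n_def m_def)
  qed
qed

theorem proposition5p1:
  fixes G :: "('a, 'c) monoid_scheme"
  assumes "n_centralizer_group 4 G"
  shows "L_integral (non_commuting_graph G)"
proof (rule L_integral_complete_multipartite)
  show "graph (non_commuting_graph G)"
    using assms by (intro graph_non_commuting_graph) (simp add: n_centralizer_group_def)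
  fix x y assume "x \<in> verts (non_commuting_graph G)" "y \<in> verts (non_commuting_graph G)"
  \<comment> \<open>The labelling \<open>p\<close> is \<open>element_centralizer G\<close>: a part
    consists of the non-central elements sharing one centralizer.\<close>
  then show "x \<rightarrow>\<^bsub>non_commuting_graph G\<^esub> y \<longleftrightarrow> element_centralizer G x \<noteq> element_centralizer G y"
    using four_centralizer_commute_iff[OF assms, of x y]
    by (auto simp: non_commuting_graph_def arcs_ends_def arc_to_ends_def)
qed

end
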